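(* Let $M=(E,\mathcal{B})$ be an even symmetric matroid on $E=[n]\cup[n]^*$. Then there is a unique $\mathcal{B}'\subseteq\mathcal{A}_n$ such that $(E,\mathcal{B}\cup\mathcal{B}')$ is an antisymmetric matroid.
   Context: $E=[n]\cup[n]^*$ with involution $i\leftrightarrow i^*$; a skew pair is $\{i,i^*\}$; $\mathcal{T}_n$ (transversals) are $n$-subsets of $E$ with no skew pair, $\mathcal{A}_n$ (almost-transversals) $n$-subsets with exactly one skew pair. A symmetric matroid is $(E,\mathcal{B})$ with $\emptyset\ne\mathcal{B}\subseteq\mathcal{T}_n$ such that for all $B_1,B_2\in\mathcal{B}$ and $x\in B_1\setminus B_2$ there is $y\in B_1\setminus B_2$ (possibly $y=x$) with $B_1\triangle\{x,x^*,y,y^*\}\in\mathcal{B}$; it is even if $|B\cap[n]|$ has the same parity for all $B\in\mathcal{B}$. An antisymmetric matroid on $E$ is $(E,\mathcal{B}'')$ with $\mathcal{B}''\subseteq\mathcal{T}_n\cup\mathcal{A}_n$ satisfying (B1) $\mathcal{B}''\ne\emptyset$; (B2) for $T\in\mathcal{T}_n$ and distinct skew pairs $p,q$, $(T\cup p)\setminus q\in\mathcal{B}''$ iff $(T\cup q)\setminus p\in\mathcal{B}''$; (Exch) for $B,B'\in\mathcal{B}''$ and $e\in B\setminus B'$ with $B\setminus\{e\}$ having no skew pair and $B'\cup\{e\}$ having exactly one skew pair, there is $f\in B'\setminus B$ with both $(B\setminus\{e\})\cup\{f\}$ and $(B'\cup\{e\})\setminus\{f\}$ in $\mathcal{B}''$.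 *)

theory Defs
  imports Main
begin

text \<open>\<open>Unst i\<close> stands for \<open>i \<in> [n]\<close> and \<open>St i\<close> for \<open>i\<^sup>* \<in> [n]\<^sup>*\<close>.\<close>

datatype elt = Unst nat | St nat

fun star :: "elt \<Rightarrow> elt" where
  "star (Unst i) = St i"
| "star (St i) = Unst i"

definition unstarred :: "nat \<Rightarrow> elt set" where
  "unstarred n = Unst ` {1..n}"

definition ground :: "nat \<Rightarrow> elt set" where
  "ground n = unstarred n \<union> star ` unstarred n"

definition skew_pairs :: "nat \<Rightarrow> elt set set" where
  "skew_pairs n = {{e, star e} | e. e \<in> ground n}"

definition skew_pairs_in :: "nat \<Rightarrow> elt set \<Rightarrow> elt set set" where
  "skew_pairs_in n A = {p \<in> skew_pairs n. p \<subseteq> A}"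

definition transversals :: "nat \<Rightarrow> elt set set" where
  "transversals n = {A. A \<subseteq> ground n \<and> card A = n \<and> skew_pairs_in n A = {}}"

definition almost_transversals :: "nat \<Rightarrow> elt set set" where
  "almost_transversals n = {A. A \<subseteq> ground n \<and> card A = n \<and> card (skew_pairs_in n A) = 1}"

definition symmetric_matroid :: "nat \<Rightarrow> elt set set \<Rightarrow> bool" where
  "symmetric_matroid n \<B> \<longleftrightarrow>
     \<B> \<noteq> {} \<and> \<B> \<subseteq> transversals n \<and>
     (\<forall>B1\<in>\<B>. \<forall>B2\<in>\<B>. \<forall>x\<in>B1 - B2. \<exists>y\<in>B1 - B2.
        sym_diff B1 {x, star x, y, star y} \<in> \<B>)"

definition even_symmetric_matroid :: "nat \<Rightarrow> elt set set \<Rightarrow> bool" where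
  "even_symmetric_matroid n \<B> \<longleftrightarrow>
     symmetric_matroid n \<B> \<and>
     (\<forall>B1\<in>\<B>. \<forall>B2\<in>\<B>. even (card (B1 \<inter> unstarred n)) = even (card (B2 \<inter> unstarred n)))"

definition antisymmetric_matroid :: "nat \<Rightarrow> elt set set \<Rightarrow> bool" where
  "antisymmetric_matroid n \<B> \<longleftrightarrow>
     \<B> \<subseteq> transversals n \<union> almost_transversals n \<and>
     \<B> \<noteq> {} \<and>
     (\<forall>T\<in>transversals n. \<forall>p\<in>skew_pairs n. \<forall>q\<in>skew_pairs n. p \<noteq> q \<longrightarrow>
        ((T \<union> p) - q \<in> \<B> \<longleftrightarrow> (T \<union> q) - p \<in> \<B>)) \<and>
     (\<forall>B\<in>\<B>. \<forall>B'\<in>\<B>. \<forall>e\<in>B - B'.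
        skew_pairs_in n (B - {e}) = {} \<and> card (skew_pairs_in n (B' \<union> {e})) = 1 \<longrightarrow>
        (\<exists>f\<in>B' - B. (B - {e}) \<union> {f} \<in> \<B> \<and> (B' \<union> {e}) - {f} \<in> \<B>))"

end

theory Submission
  imports Defs
begin

text \<open>For a set \<open>S\<close> missing exactly the skew pairs \<open>p = {i, i\<^sup>*}\<close> and \<open>q = {j, j\<^sup>*}\<close>, evenness allows
  at most two of the four transversals containing \<open>S\<close> to be bases, and those two differ in both \<open>i\<close>
  and \<open>j\<close>. Applying (Exch) to such a pair of bases puts \<open>S \<union> p\<close> into the antisymmetric matroid;
  conversely, applying it to \<open>S \<union> p\<close> and \<open>S \<union> q\<close>, which occur together by (B2), yields
  such a pair of bases. This determines \<open>\<B>'\<close>. For this \<open>\<B>'\<close>, each instance of (Exch) is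
  reduced, by replacing the almost-transversals with suitable bases near them, to the simultaneous
  exchange property of even symmetric matroids.\<close>

section \<open>Transversals and almost-transversals\<close>

lemma star_star [simp]: "star (star e) = e"
  by (cases e) auto

lemma star_neq [simp]: "star e \<noteq> e" "e \<noteq> star e"
  by (cases e; simp)+

lemma star_eq_iff [simp]: "star e = star f \<longleftrightarrow> e = f"
  by (metis star_star)

lemma star_in_ground_iff [simp]: "star e \<in> ground n \<longleftrightarrow> e \<in> ground n"
  by (cases e) (auto simp: ground_def unstarred_def image_iff)

lemma finite_ground [simp]: "finite (ground n)"
  by (simp add: ground_def unstarred_def)

lemma skew_pairs_in_empty_iff:
  "skew_pairs_in n A = {} \<longleftrightarrow> (\<forall>e\<in>ground n. \<not> (e \<in> A \<and> star e \<in> A))"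
  by (auto simp: skew_pairs_in_def skew_pairs_def)

section \<open>Counting skew pairs by their indices\<close>

fun index :: "elt \<Rightarrow> nat" where
  "index (Unst i) = i"
| "index (St i) = i"

lemma index_eq_iff: "index e = index f \<longleftrightarrow> e = f \<or> e = star f"
  by (cases e; cases f) auto

lemma ground_iff_index: "e \<in> ground n \<longleftrightarrow> index e \<in> {1..n}"
  by (cases e) (auto simp: ground_def unstarred_def image_iff)

lemma inj_on_index:
  assumes "A \<subseteq> ground n" "skew_pairs_in n A = {}"
  shows "inj_on index A"
  using assms by (auto simp: inj_on_def index_eq_iff skew_pairs_in_empty_iff)

text \<open>\<open>index\<close> identifies the skew pairs with the numbers 1 to n and is injective
  on a set without skew pairs, so such a set has n elements iff it meets every skew pair.\<close>

lemma transversals_iff: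
  "T \<in> transversals n \<longleftrightarrow> T \<subseteq> ground n \<and> (\<forall>e\<in>ground n. star e \<in> T \<longleftrightarrow> e \<notin> T)"
proof (cases "T \<subseteq> ground n \<and> skew_pairs_in n T = {}")
  case True
  then have sub: "index ` T \<subseteq> {1..n}"
    by (force simp: ground_iff_index)
  have "card T = card (index ` T)"
    using True by (metis card_image inj_on_index)
  also have "\<dots> = n \<longleftrightarrow> index ` T = {1..n}"
    using card_subset_eq[OF _ sub] by auto
  also have "\<dots> \<longleftrightarrow> (\<forall>e\<in>ground n. index e \<in> index ` T)"
  proof
    assume *: "\<forall>e\<in>ground n. index e \<in> index ` T"
    have "k \<in> index ` T" if "k \<in> {1..n}" for k
      using *[rule_format, of "Unst k"] that by (simp add: ground_iff_index)
    then show "index ` T = {1..n}"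
      using sub by blast
  qed (auto simp: ground_iff_index)
  also have "\<dots> \<longleftrightarrow> (\<forall>e\<in>ground n. e \<in> T \<or> star e \<in> T)"
    by (auto simp: image_iff index_eq_iff) (metis star_star)+
  finally show ?thesis
    using True by (auto simp: transversals_def skew_pairs_in_empty_iff)
next
  case False
  then show ?thesis
    by (auto simp: transversals_def skew_pairs_in_empty_iff)
qed

lemma transversal_subset_ground: "T \<in> transversals n \<Longrightarrow> e \<in> T \<Longrightarrow> e \<in> ground n"
  by (auto simp: transversals_iff)

lemma star_notin_transversal: "T \<in> transversals n \<Longrightarrow> e \<in> T \<Longrightarrow> star e \<notin> T"
  by (auto simp: transversals_iff)

lemma star_in_transversal:
  "T \<in> transversals n \<Longrightarrow> e \<in> ground n \<Longrightarrow> e \<notin> T \<Longrightarrow> star e \<in> T"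
  by (auto simp: transversals_iff)

lemma transversal_diffD:
  assumes "X \<in> transversals n" "Y \<in> transversals n" "e \<in> X" "e \<notin> Y"
  shows "star e \<in> Y" "star e \<notin> X"
  using assms by (meson star_in_transversal star_notin_transversal transversal_subset_ground)+

lemma finite_transversal: "T \<in> transversals n \<Longrightarrow> finite T"
  using finite_subset[OF _ finite_ground] by (auto simp: transversals_iff)

section \<open>Flips of one or two elements\<close>

lemma flip1_transversal:
  assumes "T \<in> transversals n" "x \<in> T"
  shows "insert (star x) (T - {x}) \<in> transversals n"
  unfolding transversals_iff
proof (intro conjI ballI)
  show "insert (star x) (T - {x}) \<subseteq> ground n"
    using assms by (auto dest: transversal_subset_ground)
  fix e assume "e \<in> ground n"
  then have "star e \<in> T \<longleftrightarrow> e \<notin> T"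
    using assms(1) by (simp add: transversals_iff)
  moreover have "star x \<notin> T"
    using assms by (rule star_notin_transversal)
  moreover have "e = star x \<longleftrightarrow> star e = x"
    by auto
  ultimately show "star e \<in> insert (star x) (T - {x}) \<longleftrightarrow> e \<notin> insert (star x) (T - {x})"
    using assms(2) by (cases "e = x") auto
qed

text \<open>For \<open>x\<close> and \<open>y\<close> in a transversal \<open>A\<close> this is the
  symmetric difference of \<open>A\<close> and \<open>{x, star x, y, star y}\<close>; the case
  \<open>y = x\<close> is a single flip.\<close>

definition flip :: "elt set \<Rightarrow> elt \<Rightarrow> elt \<Rightarrow> elt set" where
  "flip A x y = insert (star x) (insert (star y) (A - {x, y}))"

lemma flip_transversal:
  assumes "T \<in> transversals n" "x \<in> T" "y \<in> T" "x \<noteq> y"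
  shows "flip T x y \<in> transversals n"
proof -
  have "flip T x y = insert (star y) (insert (star x) (T - {x}) - {y})"
    using star_notin_transversal[OF assms(1)] assms by (auto simp: flip_def)
  then show ?thesis
    using assms by (metis Diff_iff flip1_transversal insert_iff singletonD)
qed

lemma flip_commute: "flip A x y = flip A y x"
  by (auto simp: flip_def)

lemma flip_flip:
  assumes "T \<in> transversals n" "x \<in> T" "y \<in> T"
  shows "flip (flip T x y) (star x) (star y) = T"
  using star_notin_transversal[OF assms(1)] assms by (auto simp: flip_def)

text \<open>Exactly one of \<open>x\<close> and \<open>star x\<close> is unstarred, so the
  intersection gains or loses one element.\<close>

lemma parity_flip1:
  assumes "T \<in> transversals n" "x \<in> T"
  shows "even (card (insert (star x) (T - {x}) \<inter> unstarred n)) \<noteq> even (card (T \<inter> unstarred n))"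
proof -
  have fin: "finite (T \<inter> unstarred n)"
    using assms finite_transversal by blast
  show ?thesis
  proof (cases x)
    case (Unst i)
    then have "insert (star x) (T - {x}) \<inter> unstarred n = (T \<inter> unstarred n) - {x}"
      and "x \<in> T \<inter> unstarred n"
      using assms transversal_subset_ground[OF assms] by (auto simp: unstarred_def ground_def)
    then show ?thesis
      using fin by (metis card.remove even_Suc finite_Diff)
  next
    case (St i)
    then have "insert (star x) (T - {x}) \<inter> unstarred n = insert (star x) (T \<inter> unstarred n)"
      using assms transversal_subset_ground[OF assms] by (auto simp: unstarred_def ground_def)
    then show ?thesis
      using fin star_notin_transversal[OF assms] by simp
  qed
qed

section \<open>Skew pairs of sets close to a transversal\<close>

lemma skew_pairs_in_subset_transversal:
  assumes "T \<in> transversals n" "A \<subseteq> T"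
  shows "skew_pairs_in n A = {}"
  using assms unfolding skew_pairs_in_def transversals_def by blast

lemma skew_pairs_in_insert_star:
  assumes "T \<in> transversals n" "A \<subseteq> T" "i \<in> A"
  shows "skew_pairs_in n (insert (star i) A) = {{i, star i}}"
proof -
  have "e = i \<or> e = star i"
    if "e \<in> insert (star i) A" "star e \<in> insert (star i) A" for e
    using that assms(2) star_notin_transversal[OF assms(1)] by (metis insert_iff star_star subsetD)
  moreover have "i \<in> ground n"
    using assms transversal_subset_ground by blast
  ultimately show ?thesis
    using assms(3) by (fastforce simp: skew_pairs_in_def skew_pairs_def)
qed

lemma skew_pairs_in_exchange:
  assumes "T \<in> transversals n" "i \<in> T" "i \<noteq> j"
  shows "skew_pairs_in n (insert (star i) (T - {j})) = {{i, star i}}"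
  using assms by (intro skew_pairs_in_insert_star) auto

lemma exchange_almost_transversal:
  assumes "T \<in> transversals n" "i \<in> T" "j \<in> T" "i \<noteq> j"
  shows "insert (star i) (T - {j}) \<in> almost_transversals n"
proof -
  have "card (insert (star i) (T - {j})) = n"
    using assms star_notin_transversal[OF assms(1,2)] finite_transversal[OF assms(1)]
    by (simp add: transversals_def) (metis Suc_pred card_gt_0_iff empty_iff)
  then show ?thesis
    using assms skew_pairs_in_exchange[OF assms(1,2,4)]
    by (auto simp: almost_transversals_def transversals_iff)
qed

text \<open>Without one half of its only skew pair, \<open>A\<close> has n - 1 elements and no skew
  pair. Some index k is then missed, and adding either element of index k gives a transversal; the
  proof adds \<open>Unst k\<close>.\<close>

lemma almost_transversalE:
  assumes "A \<in> almost_transversals n"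
  obtains T i j where "T \<in> transversals n" "i \<in> T" "j \<in> T" "i \<noteq> j"
    "A = insert (star i) (T - {j})"
proof -
  have A: "A \<subseteq> ground n" "card A = n" "card (skew_pairs_in n A) = 1"
    using assms by (auto simp: almost_transversals_def)
  then obtain p where p: "skew_pairs_in n A = {p}"
    using A(3) card_1_singletonE by metis
  then have "p \<in> skew_pairs n" by (auto simp: skew_pairs_in_def)
  with p obtain i where i: "skew_pairs_in n A = {{i, star i}}" "i \<in> ground n"
    by (auto simp: skew_pairs_def)
  then have "{i, star i} \<in> skew_pairs_in n A" by simp
  then have iA: "i \<in> A" "star i \<in> A" by (auto simp: skew_pairs_in_def)
  have fin: "finite A"
    using A(1) finite_ground by (rule finite_subset)
  define A0 where "A0 = A - {star i}"
  have "e = i \<or> e = star i" if "e \<in> A" "star e \<in> A" for e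
  proof -
    have "{e, star e} \<in> skew_pairs_in n A"
      using that A by (auto simp: skew_pairs_in_def skew_pairs_def)
    then show ?thesis using i by auto
  qed
  then have no_pair: "\<not> (e \<in> A0 \<and> star e \<in> A0)" for e
    by (auto simp: A0_def)
  have card0: "Suc (card A0) = n" "finite A0"
    using card.remove[OF fin iA(2)] fin A(2) by (simp_all add: A0_def)
  have "card (index ` A0) < card {1..n}"
    using card_image_le[OF card0(2), of index] card0 by auto
  then have "\<not> {1..n} \<subseteq> index ` A0"
    using card0 by (metis card_mono finite_imageI not_le)
  then obtain k where k: "k \<in> {1..n}" "k \<notin> index ` A0" by blast
  define j where "j = Unst k"
  have j: "j \<notin> A0" "star j \<notin> A0" "j \<in> ground n"
    using k by (force simp: j_def ground_iff_index)+
  show thesis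
  proof (rule that[of "insert j A0" i j])
    show "insert j A0 \<in> transversals n"
      using A card0 j no_pair
      by (auto simp: transversals_def skew_pairs_in_empty_iff) (auto simp: A0_def)
    show "A = insert (star i) (insert j A0 - {j})" "i \<in> insert j A0" "i \<noteq> j"
      using iA j by (auto simp: A0_def)
  qed simp
qed

lemma transversal_not_almost: "A \<in> transversals n \<Longrightarrow> A \<notin> almost_transversals n"
  by (auto simp: transversals_def almost_transversals_def)

section \<open>Strong exchange in even symmetric matroids\<close>

lemma even_symmetric_matroid_transversal:
  "even_symmetric_matroid n \<B> \<Longrightarrow> B \<in> \<B> \<Longrightarrow> B \<in> transversals n"
  by (auto simp: even_symmetric_matroid_def symmetric_matroid_def)

lemma even_symmetric_matroid_flip1:
  assumes "even_symmetric_matroid n \<B>" "B \<in> \<B>" "x \<in> B"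
  shows "insert (star x) (B - {x}) \<notin> \<B>"
proof
  assume "insert (star x) (B - {x}) \<in> \<B>"
  then have "even (card (insert (star x) (B - {x}) \<inter> unstarred n)) = even (card (B \<inter> unstarred n))"
    using assms(1,2) unfolding even_symmetric_matroid_def by (elim conjE) (drule bspec, assumption)+
  then show False
    using parity_flip1[OF even_symmetric_matroid_transversal[OF assms(1,2)] assms(3)] by contradiction
qed

text \<open>The choice \<open>y = x\<close> in the axiom would be a single flip, which evenness
  forbids.\<close>

lemma even_symmetric_matroid_exchange:
  assumes "even_symmetric_matroid n \<B>" "X \<in> \<B>" "Y \<in> \<B>" "x \<in> X - Y"
  shows "\<exists>y\<in>X - Y. y \<noteq> x \<and> flip X x y \<in> \<B>"
proof -
  have "\<forall>B1\<in>\<B>. \<forall>B2\<in>\<B>. \<forall>x\<in>B1 - B2. \<exists>y\<in>B1 - B2.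
      sym_diff B1 {x, star x, y, star y} \<in> \<B>"
    using assms(1) unfolding even_symmetric_matroid_def symmetric_matroid_def by (elim conjE)
  then obtain y where y: "y \<in> X - Y" "sym_diff X {x, star x, y, star y} \<in> \<B>"
    using assms(2-4) by meson
  have stars: "star x \<notin> X" "star y \<notin> X"
    using star_notin_transversal[OF even_symmetric_matroid_transversal[OF assms(1,2)]] assms(4) y(1)
    by blast+
  then have eq: "sym_diff X {x, star x, y, star y} = flip X x y"
    using assms(4) y(1) by (auto simp: flip_def)
  have "y \<noteq> x"
  proof
    assume "y = x"
    then have "insert (star x) (X - {x}) \<in> \<B>"
      using y(2) eq by (simp add: flip_def)
    then show False
      using even_symmetric_matroid_flip1[OF assms(1,2), of x] assms(4) by blast
  qed
  then show ?thesis
    using y eq by auto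
qed

text \<open>Let \<open>N\<close> and \<open>K\<close> be the partners of \<open>x\<close> for exchange in \<open>X\<close> and in \<open>Y\<close>, and suppose that they
  are disjoint. Take a basis \<open>Z\<close> between \<open>X\<close> and \<open>Y\<close> minimising \<open>|N - Z| + |K \<inter> Z|\<close>. If \<open>x \<notin> Z\<close>, then
  \<open>N - Z\<close> is nonempty, and exchanging one of its elements into \<open>Z\<close> towards \<open>X\<close> shrinks \<open>N - Z\<close> without
  increasing the sum; moreover \<open>x\<close> stays outside \<open>Z\<close>, as its entry would lower the sum. Repetition
  empties \<open>N - Z\<close>, which is absurd. The case \<open>x \<in> Z\<close> is dual.\<close>

lemma even_symmetric_matroid_strong_exchange:
  assumes M: "even_symmetric_matroid n \<B>" and X: "X \<in> \<B>" and Y: "Y \<in> \<B>" and x: "x \<in> X - Y"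
  shows "\<exists>y\<in>X - Y. y \<noteq> x \<and> flip X x y \<in> \<B> \<and> flip Y (star x) (star y) \<in> \<B>"
proof (rule ccontr)
  assume no: "\<not> ?thesis"
  note tr = even_symmetric_matroid_transversal[OF M]
  define N where "N = {y \<in> X - Y. y \<noteq> x \<and> flip X x y \<in> \<B>}"
  define K where "K = {y \<in> X - Y. y \<noteq> x \<and> flip Y (star x) (star y) \<in> \<B>}"
  have disj: "N \<inter> K = {}" using no by (auto simp: N_def K_def)
  have fin: "finite N" "finite K"
    using finite_transversal[OF tr[OF X]] by (auto simp: N_def K_def)
  \<comment> \<open>For a basis \<open>Z\<close> this inclusion also forces \<open>Z\<close> into
    the union of \<open>X\<close> and \<open>Y\<close>: an element outside both would have its star
    in \<open>X \<inter> Y\<close>, hence in \<open>Z\<close>.\<close>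
  define \<Z> where "\<Z> = {Z \<in> \<B>. X \<inter> Y \<subseteq> Z}"
  define \<phi> where "\<phi> Z = card (N - Z) + card (K \<inter> Z)" for Z
  obtain Z where Z: "Z \<in> \<Z>" and Zmin: "\<And>Z'. Z' \<in> \<Z> \<Longrightarrow> \<phi> Z \<le> \<phi> Z'"
    using ex_has_least_nat[of "\<lambda>Z. Z \<in> \<Z>" X \<phi>] X by (auto simp: \<Z>_def)
  show False
  proof (cases "x \<in> Z")
    case False
    \<comment> \<open>A second minimisation, of \<open>card (N - W)\<close> among the minimisers of
      \<open>\<phi>\<close> avoiding \<open>x\<close>, replaces the repetition: one further exchange
      is already contradictory.\<close>
    obtain W where W: "W \<in> \<Z>" "\<phi> W = \<phi> Z" "x \<notin> W"
      and Wmin: "\<And>Z'. Z' \<in> \<Z> \<Longrightarrow> \<phi> Z' = \<phi> Z \<Longrightarrow> x \<notin> Z' \<Longrightarrow> card (N - W) \<le> card (N - Z')"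
      using ex_has_least_nat[of "\<lambda>W. W \<in> \<Z> \<and> \<phi> W = \<phi> Z \<and> x \<notin> W" Z "\<lambda>W. card (N - W)"] Z False
      by blast
    have WB: "W \<in> \<B>" and XY: "X \<inter> Y \<subseteq> W" using W by (auto simp: \<Z>_def)
    obtain y where y: "y \<in> X - W" "y \<noteq> x" "flip X x y \<in> \<B>"
      using even_symmetric_matroid_exchange[OF M X WB, of x] x W by blast
    then have yN: "y \<in> N" "y \<notin> W" using XY by (auto simp: N_def)
    have "star y \<in> W - X"
      using transversal_diffD[OF tr[OF X] tr[OF WB]] y by blast
    from even_symmetric_matroid_exchange[OF M WB X this]
    obtain z' where z': "z' \<in> W - X" "z' \<noteq> star y" "flip W (star y) z' \<in> \<B>" by blast
    define z where "z = star z'"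
    have z: "z \<in> X" "z \<notin> W" "z \<noteq> y"
      using transversal_diffD[OF tr[OF WB] tr[OF X]] z' by (auto simp: z_def)
    define V where "V = flip W (star y) z'"
    have V: "V = insert y (insert z (W - {star y, star z}))"
      by (simp add: V_def flip_def z_def)
    have starX: "star y \<notin> X" "star z \<notin> X"
      using z y star_notin_transversal[OF tr[OF X]] by auto
    have VZ: "V \<in> \<Z>"
      using z' XY starX by (auto simp: \<Z>_def V_def[symmetric]) (auto simp: V)
    \<comment> \<open>The elements leaving \<open>W\<close> lie outside \<open>X\<close>, hence
      outside \<open>N\<close> and \<open>K\<close>. Of those entering, \<open>y\<close> is in
      \<open>N\<close> and so not in \<open>K\<close>; only \<open>z\<close> can enlarge
      \<open>K \<inter> W\<close>.\<close>
    have NV: "N - V = N - W - {y, z}"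
      using starX by (auto simp: V N_def)
    have KV: "K \<inter> V = (K \<inter> W) \<union> (K \<inter> {z})"
      using starX yN disj by (auto simp: V K_def)
    have lt: "card (N - V) < card (N - W)"
      unfolding NV using yN fin by (intro psubset_card_mono) auto
    have "z \<in> K"
    proof (rule ccontr)
      assume "z \<notin> K"
      then have "\<phi> V < \<phi> W" using lt by (simp add: \<phi>_def KV)
      then show False using Zmin[OF VZ] W by simp
    qed
    then have "z \<noteq> x" by (auto simp: K_def)
    have "card (K \<inter> V) \<le> Suc (card (K \<inter> W))"
      unfolding KV using \<open>z \<in> K\<close> fin by (simp add: card_insert_if)
    then have "\<phi> V \<le> \<phi> W" using lt by (simp add: \<phi>_def)
    then have "\<phi> V = \<phi> Z" using Zmin[OF VZ] W by simp
    moreover have "x \<notin> V" using W y \<open>z \<noteq> x\<close> by (auto simp: V)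
    ultimately show False using Wmin[OF VZ] lt by simp
  next
    case True
    obtain W where W: "W \<in> \<Z>" "\<phi> W = \<phi> Z" "x \<in> W"
      and Wmin: "\<And>Z'. Z' \<in> \<Z> \<Longrightarrow> \<phi> Z' = \<phi> Z \<Longrightarrow> x \<in> Z' \<Longrightarrow> card (K \<inter> W) \<le> card (K \<inter> Z')"
      using ex_has_least_nat[of "\<lambda>W. W \<in> \<Z> \<and> \<phi> W = \<phi> Z \<and> x \<in> W" Z "\<lambda>W. card (K \<inter> W)"] Z True
      by blast
    have WB: "W \<in> \<B>" and XY: "X \<inter> Y \<subseteq> W" using W by (auto simp: \<Z>_def)
    \<comment> \<open>Exchanging \<open>star x\<close> out of \<open>Y\<close> towards
      \<open>W\<close> yields an element \<open>y\<close> of \<open>K \<inter> W\<close>; this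
      \<open>y\<close> then leaves \<open>W\<close> towards \<open>Y\<close>.\<close>
    have "star x \<in> Y - W"
      using transversal_diffD[OF tr[OF X] tr[OF Y]] star_notin_transversal[OF tr[OF WB]] x W by blast
    from even_symmetric_matroid_exchange[OF M Y WB this]
    obtain y' where y': "y' \<in> Y - W" "y' \<noteq> star x" "flip Y (star x) y' \<in> \<B>" by blast
    define y where "y = star y'"
    have y: "y \<in> W" "y \<notin> Y" "y \<noteq> x"
      using transversal_diffD[OF tr[OF Y] tr[OF WB]] y' by (auto simp: y_def)
    have "y' \<notin> X" using XY y' by auto
    then have "y \<in> X"
      using transversal_diffD[OF tr[OF Y] tr[OF X]] y' by (auto simp: y_def)
    then have yK: "y \<in> K" "y \<in> W" using y y' by (auto simp: K_def y_def)
    from y even_symmetric_matroid_exchange[OF M WB Y, of y]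
    obtain z where z: "z \<in> W" "z \<notin> Y" "z \<noteq> y" "flip W y z \<in> \<B>" by blast
    define V where "V = flip W y z"
    have starX: "star y \<notin> X" using \<open>y \<in> X\<close> star_notin_transversal[OF tr[OF X]] by auto
    have "star z \<in> Y" using z transversal_diffD[OF tr[OF WB] tr[OF Y]] by auto
    then have starXY: "star z \<notin> X - Y" "star y \<notin> X - Y" using starX by auto
    have VZ: "V \<in> \<Z>"
      using z y XY by (auto simp: \<Z>_def V_def[symmetric]) (auto simp: V_def flip_def)
    have KV: "K \<inter> V = K \<inter> W - {y, z}"
      using starXY by (auto simp: V_def flip_def K_def)
    have NV: "N - V = (N - W) \<union> (N \<inter> {z})"
      using starXY yK disj by (auto simp: V_def flip_def N_def)
    have lt: "card (K \<inter> V) < card (K \<inter> W)"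
      unfolding KV using yK fin by (intro psubset_card_mono) auto
    have "z \<in> N"
    proof (rule ccontr)
      assume "z \<notin> N"
      then have "\<phi> V < \<phi> W" using lt by (simp add: \<phi>_def NV)
      then show False using Zmin[OF VZ] W by simp
    qed
    then have "z \<noteq> x" by (auto simp: N_def)
    have "card (N - V) \<le> Suc (card (N - W))"
      unfolding NV using \<open>z \<in> N\<close> fin by (simp add: card_insert_if)
    then have "\<phi> V \<le> \<phi> W" using lt by (simp add: \<phi>_def)
    then have "\<phi> V = \<phi> Z" using Zmin[OF VZ] W by simp
    moreover have "x \<in> V" using W y \<open>z \<noteq> x\<close> by (auto simp: V_def flip_def)
    ultimately show False using Wmin[OF VZ] lt by simp
  qed
qed

section \<open>The completion by almost-transversals\<close>

text \<open>With \<open>T = S \<union> {i, j}\<close> the condition says that \<open>S \<union> {i, j}\<close> and \<open>S \<union> {i\<^sup>*, j\<^sup>*}\<close> are both bases,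
  and the set added is \<open>S \<union> {i, i\<^sup>*}\<close>.\<close>

definition completion :: "elt set set \<Rightarrow> elt set set" where
  "completion \<B> = {insert (star i) (T - {j}) | T i j.
     T \<in> \<B> \<and> i \<in> T \<and> j \<in> T \<and> i \<noteq> j \<and> flip T i j \<in> \<B>}"

section \<open>Existence: the completion is an antisymmetric matroid\<close>

lemma completionI:
  assumes "T \<in> \<B>" "i \<in> T" "j \<in> T" "i \<noteq> j" "flip T i j \<in> \<B>"
  shows "insert (star i) (T - {j}) \<in> completion \<B>"
  using assms by (auto simp: completion_def)

text \<open>The two bases that witness a member of the completion can trade places, so either half
  of its skew pair, and either half of the missing one, may be taken to lie in the chosen
  basis.\<close>

lemma completion_star:
  assumes "T \<in> transversals n" "i \<in> T" "j \<in> T" "i \<noteq> j"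
  shows "star i \<in> flip T i j" "star j \<in> flip T i j"
    "insert (star (star i)) (flip T i j - {star j}) = insert (star i) (T - {j})"
  using assms star_notin_transversal[OF assms(1)] by (auto simp: flip_def)

lemma completion_almost_transversals:
  assumes "\<B> \<subseteq> transversals n"
  shows "completion \<B> \<subseteq> almost_transversals n"
  using assms by (auto simp: completion_def intro!: exchange_almost_transversal)

text \<open>Reduces the left half of (Exch) to a basis: each exchange of \<open>e\<close> with
  \<open>y\<close> in \<open>C\<close> gives one for \<open>B\<close> with
  \<open>f = star y\<close>. If \<open>B\<close> is a basis, take \<open>C = B\<close>. Otherwise
  \<open>e\<close> must lie in the skew pair of \<open>B\<close>, and \<open>C\<close> is the
  witnessing basis that contains \<open>e\<close>.\<close>

lemma completion_left_exchange:
  assumes sub: "\<B> \<subseteq> transversals n" and B: "B \<in> \<B> \<union> completion \<B>" and e: "e \<in> B"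
    and no_pair: "skew_pairs_in n (B - {e}) = {}"
  shows "\<exists>C\<in>\<B>. e \<in> C \<and> (\<forall>y\<in>C. y \<noteq> e \<longrightarrow> flip C e y \<in> \<B> \<longrightarrow>
           star y \<notin> B \<and> insert (star y) (B - {e}) \<in> \<B> \<union> completion \<B>)"
proof (cases "B \<in> \<B>")
  case True
  then have "star y \<notin> B \<and> insert (star y) (B - {e}) \<in> completion \<B>"
    if "y \<in> B" "y \<noteq> e" "flip B e y \<in> \<B>" for y
    using that e sub star_notin_transversal[of B n y] completionI[of B \<B> y e]
    by (auto simp: flip_commute[of B y e])
  then show ?thesis
    using True e by blast
next
  case False
  then obtain T i j where T: "T \<in> \<B>" "i \<in> T" "j \<in> T" "i \<noteq> j" "flip T i j \<in> \<B>"
    "B = insert (star i) (T - {j})"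
    using B by (auto simp: completion_def)
  have "e = i \<or> e = star i"
  proof (rule ccontr)
    assume "\<not> ?thesis"
    then have "i \<in> B - {e}" "star i \<in> B - {e}" using T by auto
    moreover have "i \<in> ground n" using T sub transversal_subset_ground by blast
    ultimately show False using no_pair by (auto simp: skew_pairs_in_empty_iff)
  qed
  then obtain C j where C: "C \<in> \<B>" "e \<in> C" "j \<in> C" "e \<noteq> j" "flip C e j \<in> \<B>"
    "B = insert (star e) (C - {j})"
  proof (elim disjE)
    assume "e = star i"
    have "T \<in> transversals n" using T sub by blast
    then show thesis
      using that[of "flip T i j" "star j"] T \<open>e = star i\<close>
        completion_star[of T n i j] flip_flip[of T n i j] by auto
  qed (use T in blast)
  have Ct: "C \<in> transversals n" using C sub by blast
  note ns = star_notin_transversal[OF Ct]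
  have "star y \<notin> B \<and> insert (star y) (B - {e}) \<in> \<B> \<union> completion \<B>"
    if y: "y \<in> C" "y \<noteq> e" "flip C e y \<in> \<B>" for y
  proof
    show "star y \<notin> B" using C y ns by auto
    show "insert (star y) (B - {e}) \<in> \<B> \<union> completion \<B>"
    proof (cases "y = j")
      case True
      then have "insert (star y) (B - {e}) = flip C e j"
        using C by (auto simp: flip_def)
      then show ?thesis using C by simp
    next
      case False
      \<comment> \<open>The bases \<open>flip C e j\<close> and \<open>flip C e y\<close> differ
        exactly in the pairs of \<open>y\<close> and \<open>j\<close>, so they witness the new
        set.\<close>
      have "flip (flip C e j) y (star j) = flip C e y"
        using C y ns False by (auto simp: flip_def)
      moreover have "insert (star y) (flip C e j - {star j}) = insert (star y) (B - {e})"
        using C y ns False by (auto simp: flip_def)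
      moreover have "y \<in> flip C e j" "star j \<in> flip C e j" "y \<noteq> star j"
        using C y ns False by (auto simp: flip_def)
      ultimately show ?thesis
        using completionI[OF C(5), of y "star j"] y by auto
    qed
  qed
  then show ?thesis using C by blast
qed

text \<open>The counterpart for the set that receives \<open>e\<close>. If \<open>B\<close> is not a
  basis, it already has a skew pair, so \<open>e\<close> must come from the pair that
  \<open>B\<close> misses, and \<open>C\<close> is the witnessing basis that avoids
  \<open>e\<close>.\<close>

lemma completion_right_exchange:
  assumes sub: "\<B> \<subseteq> transversals n" and B: "B \<in> \<B> \<union> completion \<B>"
    and e: "e \<in> ground n" "e \<notin> B"
    and one_pair: "card (skew_pairs_in n (insert e B)) = 1"
  shows "\<exists>C\<in>\<B>. e \<notin> C \<and> (\<forall>y\<in>ground n. y \<notin> C \<longrightarrow> y \<noteq> e \<longrightarrow> flip C (star e) (star y) \<in> \<B> \<longrightarrow>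
           star y \<in> B \<and> insert e B - {star y} \<in> \<B> \<union> completion \<B>)"
proof (cases "B \<in> \<B>")
  case True
  then have Bt: "B \<in> transversals n" using sub by blast
  have "insert e B - {star y} \<in> completion \<B>"
    if y: "y \<in> ground n" "y \<notin> B" "y \<noteq> e" "flip B (star e) (star y) \<in> \<B>" for y
  proof -
    have "insert e B - {star y} = insert e (B - {star y})"
      using e y star_in_transversal[OF Bt] by auto
    then show ?thesis
      using completionI[OF True, of "star e" "star y"] star_in_transversal[OF Bt] e y by simp
  qed
  then show ?thesis
    using True e star_in_transversal[OF Bt] by blast
next
  case False
  then obtain T i j where T: "T \<in> \<B>" "i \<in> T" "j \<in> T" "i \<noteq> j" "flip T i j \<in> \<B>"
    "B = insert (star i) (T - {j})"
    using B by (auto simp: completion_def)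
  have Tt: "T \<in> transversals n" using T sub by blast
  have ig: "i \<in> ground n" using T Tt transversal_subset_ground by blast
  \<comment> \<open>Otherwise \<open>star e\<close> is in \<open>B\<close>, and adding
    \<open>e\<close> creates a second skew pair.\<close>
  have "e = j \<or> e = star j"
  proof (rule ccontr)
    assume "\<not> ?thesis"
    then have "star e \<in> T - {j}" using e T star_in_transversal[OF Tt] by fastforce
    then have "{e, star e} \<in> skew_pairs_in n (insert e B)"
      "{i, star i} \<in> skew_pairs_in n (insert e B)"
      using T e ig by (auto simp: skew_pairs_in_def skew_pairs_def)
    moreover have "{e, star e} \<noteq> {i, star i}" using e T by auto
    ultimately show False using one_pair by (metis card_1_singletonE singletonD)
  qed
  then obtain C k where C: "C \<in> \<B>" "k \<in> C" "star e \<in> C" "k \<noteq> star e" "flip C k (star e) \<in> \<B>"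
    "B = insert (star k) (C - {star e})"
  proof (elim disjE)
    assume "e = j"
    then show thesis
      using that[of "flip T i j" "star i"] T completion_star[OF Tt, of i j] flip_flip[OF Tt, of i j]
      by auto
  next
    assume "e = star j"
    then show thesis using that[of T i] T by simp
  qed
  have Ct: "C \<in> transversals n" using C sub by blast
  note ns = star_notin_transversal[OF Ct]
  have eC: "e \<notin> C" using ns C by force
  have "star y \<in> B \<and> insert e B - {star y} \<in> \<B> \<union> completion \<B>"
    if y: "y \<in> ground n" "y \<notin> C" "y \<noteq> e" "flip C (star e) (star y) \<in> \<B>" for y
  proof
    have yC: "star y \<in> C" using star_in_transversal[OF Ct] y by blast
    show "star y \<in> B" using C y yC by auto
    show "insert e B - {star y} \<in> \<B> \<union> completion \<B>"
    proof (cases "star y = k")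
      case True
      then have "insert e B - {star y} = flip C k (star e)"
        using C y eC by (auto simp: flip_def)
      then show ?thesis using C by simp
    next
      case False
      have kC: "star k \<notin> C" using ns C by blast
      have "flip (flip C k (star e)) (star k) (star y) = flip C (star e) (star y)"
        using C y yC eC kC False by (auto simp: flip_def)
      moreover have "insert (star (star k)) (flip C k (star e) - {star y}) = insert e B - {star y}"
        using C y yC eC kC False by (auto simp: flip_def)
      moreover have "star k \<in> flip C k (star e)" "star y \<in> flip C k (star e)" "star k \<noteq> star y"
        using C y yC False by (auto simp: flip_def)
      ultimately show ?thesis
        using completionI[OF C(5), of "star k" "star y"] y by auto
    qed
  qed
  then show ?thesis using C eC by blast
qed

text \<open>The condition on \<open>flip T i j\<close> is symmetric in \<open>i\<close> and
  \<open>j\<close>, so the same two bases witness both sets in (B2).\<close>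

lemma completion_swap_pairs:
  assumes sub: "\<B> \<subseteq> transversals n" and T: "T \<in> transversals n"
    and p: "p \<in> skew_pairs n" and q: "q \<in> skew_pairs n" and pq: "p \<noteq> q"
    and B: "(T \<union> p) - q \<in> \<B> \<union> completion \<B>"
  shows "(T \<union> q) - p \<in> \<B> \<union> completion \<B>"
proof -
  obtain a where a: "p = {a, star a}" "a \<in> ground n"
    using p by (auto simp: skew_pairs_def)
  obtain b where b: "q = {b, star b}" "b \<in> ground n"
    using q by (auto simp: skew_pairs_def)
  have ab: "a \<noteq> b" "a \<noteq> star b" "star a \<noteq> b"
    using pq a b by auto
  have "(T \<union> p) - q \<notin> transversals n"
    using ab a b by (auto simp: transversals_iff)
  then obtain U i j where U: "U \<in> \<B>" "i \<in> U" "j \<in> U" "i \<noteq> j" "flip U i j \<in> \<B>"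
    "(T \<union> p) - q = insert (star i) (U - {j})"
    using B sub by (auto simp: completion_def)
  have Ut: "U \<in> transversals n" using U sub by blast
  have "p \<in> skew_pairs_in n ((T \<union> p) - q)"
    using p ab a b by (auto simp: skew_pairs_in_def)
  then have pi: "p = {i, star i}"
    using skew_pairs_in_exchange[OF Ut U(2,4)] U(6) by simp
  \<comment> \<open>The transversal \<open>U\<close> contains one half of \<open>q\<close>, but the
    set contains neither; the removed \<open>j\<close> is therefore that half.\<close>
  have "b \<notin> insert (star i) (U - {j})" "star b \<notin> insert (star i) (U - {j})"
    using U(6)[symmetric] b by auto
  then have "b = j \<or> star b = j"
    using star_in_transversal[OF Ut b(2)] by auto
  then have qj: "q = {j, star j}" using b by auto
  have "(T \<union> q) - p = (((T \<union> p) - q) - p) \<union> q"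
    using pq ab a b by auto
  also have "\<dots> = (insert (star i) (U - {j}) - p) \<union> q"
    by (simp only: U(6))
  also have "\<dots> = insert (star j) (U - {i})"
    unfolding pi qj using U(2-4) star_notin_transversal[OF Ut] by auto
  finally show ?thesis
    using completionI[OF U(1,3,2)] U by (simp add: flip_commute)
qed

lemma antisymmetric_matroid_completion:
  assumes M: "even_symmetric_matroid n \<B>"
  shows "antisymmetric_matroid n (\<B> \<union> completion \<B>)"
proof -
  have sub: "\<B> \<subseteq> transversals n" and ne: "\<B> \<noteq> {}"
    using M by (auto simp: even_symmetric_matroid_def symmetric_matroid_def)
  have exch: "\<exists>f\<in>B' - B. (B - {e}) \<union> {f} \<in> \<B> \<union> completion \<B> \<and> (B' \<union> {e}) - {f} \<in> \<B> \<union> completion \<B>"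
    if BB: "B \<in> \<B> \<union> completion \<B>" "B' \<in> \<B> \<union> completion \<B>" "e \<in> B - B'"
      "skew_pairs_in n (B - {e}) = {}" "card (skew_pairs_in n (B' \<union> {e})) = 1" for B B' e
  proof -
    \<comment> \<open>Once \<open>B\<close> and \<open>B'\<close> are replaced by the bases
      \<open>C\<close> and \<open>C'\<close>, strong exchange at \<open>e\<close> supplies one
      \<open>y\<close> for both sides, and \<open>f = star y\<close>.\<close>
    obtain C where C: "C \<in> \<B>" "e \<in> C"
      "\<And>y. y \<in> C \<Longrightarrow> y \<noteq> e \<Longrightarrow> flip C e y \<in> \<B> \<Longrightarrow>
           star y \<notin> B \<and> insert (star y) (B - {e}) \<in> \<B> \<union> completion \<B>"
      using completion_left_exchange[OF sub BB(1), of e] BB by blast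
    have eg: "e \<in> ground n" using C sub transversal_subset_ground by blast
    obtain C' where C': "C' \<in> \<B>" "e \<notin> C'"
      "\<And>y. y \<in> ground n \<Longrightarrow> y \<notin> C' \<Longrightarrow> y \<noteq> e \<Longrightarrow> flip C' (star e) (star y) \<in> \<B> \<Longrightarrow>
           star y \<in> B' \<and> insert e B' - {star y} \<in> \<B> \<union> completion \<B>"
      using completion_right_exchange[OF sub BB(2) eg] BB by auto
    obtain y where y: "y \<in> C - C'" "y \<noteq> e" "flip C e y \<in> \<B>" "flip C' (star e) (star y) \<in> \<B>"
      using even_symmetric_matroid_strong_exchange[OF M C(1) C'(1), of e] C C' by blast
    have "y \<in> ground n" using y C sub transversal_subset_ground by blast
    then show ?thesis
      using C(3)[of y] C'(3)[of y] y by (intro bexI[of _ "star y"]) auto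
  qed
  have "(T \<union> p) - q \<in> \<B> \<union> completion \<B> \<longleftrightarrow> (T \<union> q) - p \<in> \<B> \<union> completion \<B>"
    if "T \<in> transversals n" "p \<in> skew_pairs n" "q \<in> skew_pairs n" "p \<noteq> q" for T p q
    using completion_swap_pairs[OF sub] that by metis
  then show ?thesis
    unfolding antisymmetric_matroid_def
    using exch sub ne completion_almost_transversals[OF sub] by blast
qed

section \<open>Uniqueness of the added almost-transversals\<close>

lemma antisymmetric_matroid_eq_completion:
  assumes M: "even_symmetric_matroid n \<B>" and sub: "\<C> \<subseteq> almost_transversals n"
    and anti: "antisymmetric_matroid n (\<B> \<union> \<C>)"
  shows "\<C> = completion \<B>"
proof
  note tr = even_symmetric_matroid_transversal[OF M]
  have trB: "A \<in> \<B>" if "A \<in> \<B> \<union> \<C>" "A \<in> transversals n" for A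
    using that sub transversal_not_almost by blast
  have swap: "(T \<union> p) - q \<in> \<B> \<union> \<C> \<longleftrightarrow> (T \<union> q) - p \<in> \<B> \<union> \<C>"
    if "T \<in> transversals n" "p \<in> skew_pairs n" "q \<in> skew_pairs n" "p \<noteq> q" for T p q
  proof -
    have "\<forall>T\<in>transversals n. \<forall>p\<in>skew_pairs n. \<forall>q\<in>skew_pairs n. p \<noteq> q \<longrightarrow>
        ((T \<union> p) - q \<in> \<B> \<union> \<C> \<longleftrightarrow> (T \<union> q) - p \<in> \<B> \<union> \<C>)"
      using anti unfolding antisymmetric_matroid_def by (elim conjE)
    then show ?thesis using that by metis
  qed
  have exch: "\<exists>f\<in>B' - B. insert f (B - {e}) \<in> \<B> \<union> \<C> \<and> insert e B' - {f} \<in> \<B> \<union> \<C>"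
    if "B \<in> \<B> \<union> \<C>" "B' \<in> \<B> \<union> \<C>" "e \<in> B - B'"
      "skew_pairs_in n (B - {e}) = {}" "card (skew_pairs_in n (insert e B')) = 1" for B B' e
    using anti that unfolding antisymmetric_matroid_def by auto
  show "completion \<B> \<subseteq> \<C>"
  proof
    fix A assume "A \<in> completion \<B>"
    then obtain T i j where T: "T \<in> \<B>" "i \<in> T" "j \<in> T" "i \<noteq> j" "flip T i j \<in> \<B>"
      "A = insert (star i) (T - {j})"
      by (auto simp: completion_def)
    have Tt: "T \<in> transversals n" using tr T by blast
    note ns = star_notin_transversal[OF Tt]
    define U where "U = flip T i j"
    have jU: "j \<notin> U" using T ns by (auto simp: U_def flip_def)
    have np: "skew_pairs_in n (T - {j}) = {}"
      using skew_pairs_in_subset_transversal[OF Tt] by blast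
    have "star j \<in> U" by (simp add: U_def flip_def)
    then have "card (skew_pairs_in n (insert j U)) = 1"
      using skew_pairs_in_insert_star[OF tr[OF T(5)], of U "star j"] by (simp add: U_def)
    with exch[of T U j] T jU np obtain f where f: "f \<in> U - T" "insert f (T - {j}) \<in> \<B> \<union> \<C>"
      by (auto simp: U_def)
    have "f = star i \<or> f = star j" using f by (auto simp: U_def flip_def)
    \<comment> \<open>The choice \<open>f = star j\<close> would make a single flip of
      \<open>T\<close> a basis, against parity; hence \<open>f = star i\<close>, which gives
      \<open>A\<close>.\<close>
    moreover have "f \<noteq> star j"
      using even_symmetric_matroid_flip1[OF M T(1,3)] flip1_transversal[OF Tt T(3)] f trB by blast
    ultimately have "A \<in> \<B> \<union> \<C>" using f T by auto
    then show "A \<in> \<C>"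
      using exchange_almost_transversal[OF Tt T(2,3,4)] T(6) tr transversal_not_almost by blast
  qed
  show "\<C> \<subseteq> completion \<B>"
  proof
    fix A assume A: "A \<in> \<C>"
    then obtain T i j where T: "T \<in> transversals n" "i \<in> T" "j \<in> T" "i \<noteq> j"
      "A = insert (star i) (T - {j})"
      using sub almost_transversalE by blast
    note ns = star_notin_transversal[OF T(1)]
    have g: "i \<in> ground n" "j \<in> ground n" using T transversal_subset_ground by blast+
    have neq: "i \<noteq> star j" "star i \<noteq> j" "star i \<notin> T" "star j \<notin> T" using T ns by auto
    \<comment> \<open>With S = \<open>T - {i, j}\<close>, \<open>A\<close> is S with the pair of
      \<open>i\<close> and \<open>D\<close> is S with the pair of \<open>j\<close>. By (B2) they
      occur together, and (Exch) can move \<open>i\<close> from \<open>A\<close> to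
      \<open>D\<close>.\<close>
    define D where "D = insert (star j) (T - {i})"
    have "(T \<union> {i, star i}) - {j, star j} \<in> \<B> \<union> \<C> \<longleftrightarrow> (T \<union> {j, star j}) - {i, star i} \<in> \<B> \<union> \<C>"
    proof -
      have "{i, star i} \<in> skew_pairs n" "{j, star j} \<in> skew_pairs n" "{i, star i} \<noteq> {j, star j}"
        using g T(4) neq by (auto simp: skew_pairs_def doubleton_eq_iff)
      then show ?thesis by (rule swap[OF T(1)])
    qed
    moreover have "(T \<union> {i, star i}) - {j, star j} = A" "(T \<union> {j, star j}) - {i, star i} = D"
      using T neq by (auto simp: D_def)
    ultimately have D: "D \<in> \<B> \<union> \<C>" using A by simp
    have "A - {i} \<subseteq> insert (star i) (T - {i})"
      using T by auto
    then have np: "skew_pairs_in n (A - {i}) = {}"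
      by (rule skew_pairs_in_subset_transversal[OF flip1_transversal[OF T(1,2)]])
    have "insert i D = insert (star j) T" using T(2) by (auto simp: D_def)
    then have one: "card (skew_pairs_in n (insert i D)) = 1"
      using skew_pairs_in_insert_star[OF T(1) _ T(3)] by simp
    have "A \<in> \<B> \<union> \<C>" "i \<in> A - D"
      using A T(2,4,5) neq(1) by (simp_all add: D_def)
    from exch[OF this(1) D this(2) np one] obtain f where f: "f \<in> D - A"
      "insert f (A - {i}) \<in> \<B> \<union> \<C>" "insert i D - {f} \<in> \<B> \<union> \<C>"
      by blast
    \<comment> \<open>Either choice of \<open>f\<close> turns both sets into transversals, hence
      bases, that differ exactly in the pairs of \<open>i\<close> and \<open>j\<close>. If
      \<open>f = j\<close>, the basis containing \<open>i\<close> is not \<open>T\<close> but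
      \<open>T\<close> with \<open>j\<close> flipped.\<close>
    have "f = j \<or> f = star j" using f T by (auto simp: D_def)
    then show "A \<in> completion \<B>"
    proof
      assume fj: "f = j"
      define U where "U = insert (star j) (T - {j})"
      have Ut: "U \<in> transversals n" unfolding U_def using flip1_transversal T by blast
      have U: "i \<in> U" "star j \<in> U" using T by (auto simp: U_def)
      have "insert i D - {f} = U" using T neq fj by (auto simp: D_def U_def)
      then have "U \<in> \<B>" using f Ut trB by simp
      moreover have "insert f (A - {i}) = flip U i (star j)"
        using T neq fj by (auto simp: flip_def U_def)
      then have "flip U i (star j) \<in> \<B>"
        using f trB flip_transversal[OF Ut U] neq by simp
      moreover have "A = insert (star i) (U - {star j})"
        using T neq by (auto simp: U_def)
      ultimately show ?thesis using completionI[of U \<B> i "star j"] U neq by simp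
    next
      assume fj: "f = star j"
      have "insert i D - {f} = T" using T neq fj by (auto simp: D_def)
      then have "T \<in> \<B>" using f T trB by simp
      moreover have "insert f (A - {i}) = flip T i j"
        using T neq fj by (auto simp: flip_def)
      then have "flip T i j \<in> \<B>"
        using f trB flip_transversal[OF T(1-4)] by simp
      ultimately show ?thesis using completionI[of T \<B> i j] T by simp
    qed
  qed
qed

theorem theorem4p13:
  fixes n :: nat and \<B> :: "elt set set"
  assumes "even_symmetric_matroid n \<B>"
  shows "\<exists>!\<B>'. \<B>' \<subseteq> almost_transversals n \<and> antisymmetric_matroid n (\<B> \<union> \<B>')"
proof (rule ex1I[of _ "completion \<B>"])
  have "\<B> \<subseteq> transversals n"
    using even_symmetric_matroid_transversal[OF assms] by blast
  then show "completion \<B> \<subseteq> almost_transversals n \<and> antisymmetric_matroid n (\<B> \<union> completion \<B>)"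
    using completion_almost_transversals antisymmetric_matroid_completion[OF assms] by blast
qed (use antisymmetric_matroid_eq_completion[OF assms] in blast)

end
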